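(* Let $S\neq\mathbb{N}$ be a numerical semigroup with $2K\setminus K=\{F(S)-x_1,\dots,F(S)-x_r,F(S)\}$ ($r\ge 0$), where $x_i$ is a minimal generator of $S$ for every $i$. (1) For every $i$, there exist $f_j,f_k\in PF(S)$ such that $f_j+f_k=F(S)+x_i$. (2) For every $f\in PF(S)\setminus\{F(S)\}$, either $F(S)-f\in PF(S)$ or $F(S)-f+x_i\in PF(S)$ for some $i$.
   Context: A numerical semigroup is a submonoid $S$ of $(\mathbb{N},+)$ (with $0\in\mathbb{N}$) such that $\mathbb{N}\setminus S$ is finite. $F(S)=\max(\mathbb{Z}\setminus S)$, $M=S\setminus\{0\}$, $K=\{x\in\mathbb{N}\mid F(S)-x\notin S\}$, $2K=K+K$. $S$ has a unique minimal system of generators, whose elements are the minimal generators of $S$. $PF(S)=\{x\in\mathbb{Z}\setminus S\mid x+M\subseteq S\}$. *)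

theory Defs
  imports HOL.Hull "HOL-Library.Set_Algebras"
begin

definition submonoid :: "nat set \<Rightarrow> bool" where
  "submonoid T \<longleftrightarrow> 0 \<in> T \<and> (\<forall>a\<in>T. \<forall>b\<in>T. a + b \<in> T)"

definition numerical_semigroup :: "nat set \<Rightarrow> bool" where
  "numerical_semigroup S \<longleftrightarrow> submonoid S \<and> finite (- S)"

text \<open>
  The Frobenius number, the pseudo-Frobenius numbers and the standard canonical ideal involve
  differences, so they live in the integers; a semigroup \<open>S\<close> is viewed there as \<open>int ` S\<close>.
  \<open>GREATEST\<close> is used for the maximum because the complement of \<open>int ` S\<close> is infinite,
  where \<open>Max\<close> is unspecified. The Frobenius number of \<open>UNIV\<close> is \<open>- 1\<close>.
\<close>

definition Frobenius :: "nat set \<Rightarrow> int" where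
  "Frobenius S = (GREATEST z. z \<notin> int ` S)"

definition PF :: "nat set \<Rightarrow> int set" where
  "PF S = {z. z \<notin> int ` S \<and> (\<forall>m\<in>S - {0}. z + int m \<in> int ` S)}"

definition K :: "nat set \<Rightarrow> int set" where
  "K S = {z. 0 \<le> z \<and> Frobenius S - z \<notin> int ` S}"

definition minimal_generating_system :: "nat set \<Rightarrow> nat set \<Rightarrow> bool" where
  "minimal_generating_system S A \<longleftrightarrow>
     submonoid hull A = S \<and> (\<forall>B. B \<subset> A \<longrightarrow> submonoid hull B \<noteq> S)"

definition minimal_generators :: "nat set \<Rightarrow> nat set" where
  "minimal_generators S = (THE A. minimal_generating_system S A)"

lemma submonoid_hull: "submonoid (submonoid hull A)"
  by (rule hull_in) (auto simp: submonoid_def)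

lemma ex1_minimal_generating_system:
  assumes S: "submonoid S"
  shows "\<exists>!A. minimal_generating_system S A"
proof -
  define A where "A = {x \<in> S - {0}. \<forall>a\<in>S - {0}. \<forall>b\<in>S - {0}. x \<noteq> a + b}"
  have sub: "submonoid hull A \<subseteq> S"
    by (rule hull_minimal) (use S in \<open>auto simp: A_def\<close>)
  have sup: "x \<in> S \<longrightarrow> x \<in> submonoid hull A" for x
  proof (induction x rule: less_induct)
    case (less x)
    show ?case
    proof
      assume x: "x \<in> S"
      consider "x = 0" | "x \<in> A" | a b where "a \<in> S - {0}" "b \<in> S - {0}" "x = a + b"
        using x unfolding A_def by blast
      then show "x \<in> submonoid hull A"
      proof cases
        case 1
        then show ?thesis using submonoid_hull[of A] by (simp add: submonoid_def)
      next
        case 2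
        then show ?thesis by (rule hull_inc)
      next
        case 3
        then have "a \<in> submonoid hull A" "b \<in> submonoid hull A"
          using less.IH[of a] less.IH[of b] by auto
        then show ?thesis using 3 submonoid_hull[of A] by (simp add: submonoid_def)
      qed
    qed
  qed
  have gen: "submonoid hull A = S"
    using sub sup by blast
  have least: "A \<subseteq> B" if B: "submonoid hull B = S" for B
  proof
    fix a assume a: "a \<in> A"
    show "a \<in> B"
    proof (rule ccontr)
      assume "a \<notin> B"
      moreover have "B \<subseteq> S" using B hull_subset[of B submonoid] by simp
      ultimately have "B \<subseteq> S - {a}" by blast
      moreover have "submonoid (S - {a})"
        unfolding submonoid_def
      proof (intro conjI ballI)
        show "0 \<in> S - {a}" using S a by (simp add: submonoid_def A_def)
      next
        fix u v assume uv: "u \<in> S - {a}" "v \<in> S - {a}"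
        then have "u + v \<in> S" using S by (simp add: submonoid_def)
        moreover have "u + v \<noteq> a"
          using a uv by (cases "u = 0 \<or> v = 0") (auto simp: A_def)
        ultimately show "u + v \<in> S - {a}" by simp
      qed
      ultimately have "submonoid hull B \<subseteq> S - {a}" by (rule hull_minimal)
      then show False using B a by (auto simp: A_def)
    qed
  qed
  show ?thesis
  proof (rule ex1I[of _ A])
    show "minimal_generating_system S A"
      unfolding minimal_generating_system_def using gen least by blast
  next
    fix B assume "minimal_generating_system S B"
    then show "B = A"
      unfolding minimal_generating_system_def using gen least by blast
  qed
qed

end

theory Submission
  imports Defs
begin

text \<open>
  Write \<open>F\<close> for the Frobenius number. Reflection at \<open>F\<close> exchanges \<open>K S\<close> with the complement
  of \<open>S\<close> in the integers: \<open>z \<in> K S\<close> iff \<open>F - z \<notin> S\<close>. Moreover the pseudo-Frobenius numbers are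
  the gaps (integers outside \<open>S\<close>) that are maximal for the order \<open>a \<le> b \<longleftrightarrow> b - a \<in> S\<close>, and every gap lies below one of
  them (\<open>gap_below_PF\<close>); reflected, this says that the numbers \<open>F - f\<close> with \<open>f \<in> PF S\<close> generate
  \<open>K S\<close> over \<open>S\<close>. Both claims come from producing an element \<open>F - t\<close> of \<open>(K S + K S) - K S\<close>
  with \<open>t \<in> S\<close>, since the hypothesis then forces \<open>t = 0\<close> or \<open>t = x i\<close> for some \<open>i\<close>.

  For the first claim, write \<open>F - x i\<close> as a sum of two elements of \<open>K S\<close>, and these as \<open>F - f\<close>
  and \<open>F - g\<close> plus elements of \<open>S\<close>. So \<open>f + g = F + t\<close> with \<open>t = x i + s\<close> for some \<open>s \<in> S\<close>, and
  \<open>F - t = (F - f) + (F - g)\<close>. Hence \<open>t\<close> is zero or one of the generators \<open>x j\<close>; as a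
  minimal generator is neither zero nor a sum of two nonzero elements of \<open>S\<close>, \<open>s = 0\<close>.

  For the second claim, \<open>F - f\<close> is a gap, for otherwise it is a nonzero element of \<open>S\<close> and
  \<open>F = f + (F - f)\<close> lies in \<open>S\<close>. So \<open>F - f + t \<in> PF S\<close> for some \<open>t \<in> S\<close>.
  Now \<open>F - t = (F - f) + (f - t)\<close> is a sum of two elements of \<open>K S\<close>, so \<open>t\<close> is zero or some
  \<open>x i\<close>.
\<close>

text \<open>
  A generating set without \<open>a\<close> still generates every element of \<open>S\<close> below \<open>a\<close>. So if \<open>a\<close> were
  zero or the sum of two nonzero elements of \<open>S\<close>, it could be dropped from a generating set.
\<close>

lemma minimal_generator_indecomposable:
  assumes S: "submonoid S" and a: "a \<in> minimal_generators S"
  shows "a \<in> S" "a \<noteq> 0" "\<And>u v. u \<in> S \<Longrightarrow> v \<in> S \<Longrightarrow> a = u + v \<Longrightarrow> u = 0 \<or> v = 0"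
proof -
  define A where "A = minimal_generators S"
  define T where "T = submonoid hull (A - {a})"
  have "minimal_generating_system S A"
    unfolding A_def minimal_generators_def
    by (rule theI'[OF ex1_minimal_generating_system[OF S]])
  then have gen: "submonoid hull A = S" and min: "\<And>B. B \<subset> A \<Longrightarrow> submonoid hull B \<noteq> S"
    unfolding minimal_generating_system_def by auto
  have aA: "a \<in> A" using a by (simp add: A_def)
  have AT: "A - {a} \<subseteq> T" unfolding T_def by (rule hull_subset)
  have T: "submonoid T" unfolding T_def by (rule submonoid_hull)
  have "A \<subseteq> S" using gen hull_subset[of A submonoid] by simp
  then show "a \<in> S" using aA by blast
  have TS: "T \<subseteq> S" unfolding T_def by (rule hull_minimal) (use S \<open>A \<subseteq> S\<close> in auto)
  have aT: "a \<notin> T"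
  proof
    assume "a \<in> T"
    then have "submonoid hull A \<subseteq> T"
      using AT T by (intro hull_minimal) auto
    then have "T = S" using TS gen by blast
    moreover have "A - {a} \<subset> A" using aA by blast
    ultimately show False using min unfolding T_def by blast
  qed
  have below: "z \<in> T" if "z \<in> S" "z < a" for z
  proof -
    have "submonoid (T \<union> {a..})"
      using T by (auto simp: submonoid_def)
    moreover have "A \<subseteq> T \<union> {a..}" using AT by auto
    ultimately have "submonoid hull A \<subseteq> T \<union> {a..}" by (intro hull_minimal)
    then show ?thesis using that gen by auto
  qed
  show "a \<noteq> 0" using aT T unfolding submonoid_def by metis
  show "u = 0 \<or> v = 0" if "u \<in> S" "v \<in> S" "a = u + v" for u v
  proof (rule ccontr)
    assume "\<not> (u = 0 \<or> v = 0)"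
    then have "u \<in> T" "v \<in> T" using below that by auto
    then show False using T aT that by (auto simp: submonoid_def)
  qed
qed

lemma
  assumes "numerical_semigroup S"
  shows Frobenius_notin: "Frobenius S \<notin> int ` S"
    and notin_le_Frobenius: "z \<notin> int ` S \<Longrightarrow> z \<le> Frobenius S"
proof -
  have "finite (- S)" using assms by (simp add: numerical_semigroup_def)
  then obtain N where N: "\<And>n. n \<in> - S \<Longrightarrow> n \<le> N"
    using finite_nat_set_iff_bounded_le by auto
  have bnd: "z \<le> int N" if "z \<notin> int ` S" for z
  proof (cases "z \<ge> 0")
    case True
    then have "nat z \<in> - S" using that by (metis ComplI image_eqI int_nat_eq)
    then show ?thesis using N by fastforce
  qed auto
  \<comment> \<open>The complement is bounded above by \<open>N\<close> but unbounded below, so its greatest element is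
      reached by the first successful step of a descent from \<open>N\<close>; \<open>- 1\<close> stops the descent.\<close>
  define P where "P z \<longleftrightarrow> z \<notin> int ` S" for z
  define n where "n = (LEAST k. P (int N - int k))"
  have "P (int N - int (N + 1))" by (auto simp: P_def)
  then have n: "P (int N - int n)" unfolding n_def by (rule LeastI)
  have up: "z \<le> int N - int n" if "P z" for z
  proof -
    have "P (int N - int (nat (int N - z)))" using that bnd by (simp add: P_def)
    then have "n \<le> nat (int N - z)" unfolding n_def by (rule Least_le)
    moreover have "z \<le> int N" using that bnd by (simp add: P_def)
    ultimately show ?thesis by linarith
  qed
  have F: "Frobenius S = int N - int n"
    unfolding Frobenius_def by (rule Greatest_equality) (use n up in \<open>auto simp: P_def\<close>)
  show "Frobenius S \<notin> int ` S" using n F by (simp add: P_def)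
  show "z \<notin> int ` S \<Longrightarrow> z \<le> Frobenius S" using up F by (simp add: P_def)
qed

text \<open>
  Every integer above the Frobenius number lies in the semigroup, so \<open>z\<close> is nonnegative
  whenever \<open>Frobenius S - z\<close> is a gap.
\<close>

lemma mem_K_iff:
  assumes "numerical_semigroup S"
  shows "z \<in> K S \<longleftrightarrow> Frobenius S - z \<notin> int ` S"
  using notin_le_Frobenius[OF assms, of "Frobenius S - z"] by (auto simp: K_def)

text \<open>
  Gaps are bounded above, so among the translates of \<open>z\<close> by elements of \<open>S\<close> that are gaps
  there is a largest one; translating it further by a nonzero element of \<open>S\<close> lands in \<open>S\<close>.
\<close>

lemma gap_below_PF:
  assumes S: "numerical_semigroup S" and z: "z \<notin> int ` S"
  shows "\<exists>s\<in>S. z + int s \<in> PF S"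
proof -
  define Q where "Q s \<longleftrightarrow> s \<in> S \<and> z + int s \<notin> int ` S" for s
  have sub: "0 \<in> S" "\<And>a b. a \<in> S \<Longrightarrow> b \<in> S \<Longrightarrow> a + b \<in> S"
    using S by (auto simp: numerical_semigroup_def submonoid_def)
  have Q0: "Q 0" using z sub by (simp add: Q_def)
  have bnd: "t \<le> nat (Frobenius S - z)" if "Q t" for t
    using notin_le_Frobenius[OF S, of "z + int t"] that unfolding Q_def by linarith
  define s where "s = (GREATEST s. Q s)"
  have s: "Q s" unfolding s_def using Q0 bnd by (rule GreatestI_nat)
  have max: "t \<le> s" if "Q t" for t
    unfolding s_def using that bnd by (rule Greatest_le_nat)
  have "z + int s + int m \<in> int ` S" if "m \<in> S - {0}" for m
  proof (rule ccontr)
    assume "z + int s + int m \<notin> int ` S"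
    then have "Q (s + m)" using s that sub(2) by (simp add: Q_def add.assoc)
    then show False using max that by fastforce
  qed
  then have "z + int s \<in> PF S" using s by (simp add: Q_def PF_def)
  then show ?thesis using s by (auto simp: Q_def)
qed

text \<open>
  The lemma above, reflected at the Frobenius number: the generators of \<open>K S\<close> over \<open>S\<close>.
\<close>

lemma K_generated_by_reflected_PF:
  assumes S: "numerical_semigroup S" and k: "k \<in> K S"
  obtains f s where "f \<in> PF S" "s \<in> S" "k = Frobenius S - f + int s"
proof -
  obtain s where "s \<in> S" "Frobenius S - k + int s \<in> PF S"
    using gap_below_PF[OF S] k mem_K_iff[OF S] by blast
  then show thesis using that[of "Frobenius S - k + int s" s] by simp
qed

theorem proposition3p8:
  fixes S :: "nat set" and r :: nat and x :: "nat \<Rightarrow> nat"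
  assumes "numerical_semigroup S"
    and "S \<noteq> UNIV"
    and "(K S + K S) - K S = (\<lambda>i. Frobenius S - int (x i)) ` {1..r} \<union> {Frobenius S}"
    and "\<forall>i\<in>{1..r}. x i \<in> minimal_generators S"
  shows "(\<forall>i\<in>{1..r}. \<exists>f\<^sub>j\<in>PF S. \<exists>f\<^sub>k\<in>PF S. f\<^sub>j + f\<^sub>k = Frobenius S + int (x i)) \<and>
         (\<forall>f\<in>PF S - {Frobenius S}.
            Frobenius S - f \<in> PF S \<or>
            (\<exists>i\<in>{1..r}. Frobenius S - f + int (x i) \<in> PF S))"
proof -
  note S = assms(1)
  let ?F = "Frobenius S"
  have sub: "submonoid S" and add: "\<And>a b. a \<in> S \<Longrightarrow> b \<in> S \<Longrightarrow> a + b \<in> S"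
    using S by (auto simp: numerical_semigroup_def submonoid_def)
  note indec = minimal_generator_indecomposable[OF sub]
  have reflect_PF: "?F - f \<in> K S" if "f \<in> PF S" for f
    using that by (simp add: mem_K_iff[OF S] PF_def)
  have classify: "t = 0 \<or> (\<exists>i\<in>{1..r}. t = x i)"
    if "t \<in> S" "a \<in> K S" "b \<in> K S" "?F - int t = a + b" for t a b
  proof -
    have "?F - int t \<notin> K S" using that(1) by (simp add: mem_K_iff[OF S])
    moreover have "?F - int t \<in> K S + K S" using that by (simp add: set_plus_intro)
    ultimately have "?F - int t \<in> (\<lambda>i. ?F - int (x i)) ` {1..r} \<union> {?F}"
      using assms(3) by blast
    then show ?thesis by auto
  qed
  show ?thesis
  proof (intro conjI ballI)
    fix i assume i: "i \<in> {1..r}"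
    then have xi: "x i \<in> minimal_generators S" using assms(4) by blast
    have "?F - int (x i) \<in> K S + K S" using assms(3) i by blast
    then obtain k l where k: "k \<in> K S" and l: "l \<in> K S" and kl: "?F - int (x i) = k + l"
      by (auto elim: set_plus_elim)
    obtain f s where f: "f \<in> PF S" "s \<in> S" "k = ?F - f + int s"
      using K_generated_by_reflected_PF[OF S k] .
    obtain g t where g: "g \<in> PF S" "t \<in> S" "l = ?F - g + int t"
      using K_generated_by_reflected_PF[OF S l] .
    let ?s = "s + t"
    have s: "?s \<in> S" using add f g by blast
    have "?F - int (x i + ?s) = (?F - f) + (?F - g)" using kl f g by simp
    then have "x i + ?s = 0 \<or> (\<exists>j\<in>{1..r}. x i + ?s = x j)"
      using classify add indec(1)[OF xi] s reflect_PF f(1) g(1) by blast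
    then obtain j where j: "j \<in> {1..r}" "x j = x i + ?s"
      using indec(2)[OF xi] by auto
    then have "?s = 0"
      using indec(3)[of "x j" "x i" ?s] indec(1,2)[OF xi] s assms(4) by blast
    then have "f + g = ?F + int (x i)" using kl f g by simp
    then show "\<exists>f\<^sub>j\<in>PF S. \<exists>f\<^sub>k\<in>PF S. f\<^sub>j + f\<^sub>k = ?F + int (x i)" using f(1) g(1) by blast
  next
    fix f assume "f \<in> PF S - {?F}"
    then have f: "f \<in> PF S" and "f \<noteq> ?F" by auto
    have "?F - f \<notin> int ` S"
    proof
      assume "?F - f \<in> int ` S"
      then obtain m where m: "m \<in> S" "?F - f = int m" by blast
      then have "m \<noteq> 0" using \<open>f \<noteq> ?F\<close> by auto
      then have "f + int m \<in> int ` S" using f m(1) by (simp add: PF_def)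
      moreover have "f + int m = ?F" using m(2) by simp
      ultimately show False using Frobenius_notin[OF S] by simp
    qed
    then obtain t where t: "t \<in> S" and ft: "?F - f + int t \<in> PF S"
      using gap_below_PF[OF S] by blast
    have "f - int t \<in> K S" using reflect_PF[OF ft] by simp
    then have "t = 0 \<or> (\<exists>i\<in>{1..r}. t = x i)"
      by (intro classify[OF t reflect_PF[OF f]]) auto
    then show "?F - f \<in> PF S \<or> (\<exists>i\<in>{1..r}. ?F - f + int (x i) \<in> PF S)"
      using ft by auto
  qed
qed

end
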